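(* Let $S$ be a nilpotent-free semiring. If $B$ is a GGP $S$-semialgebra (with respect to an amount function $A: B\to\mathrm{Id}(S)$), then $B$ is an Armendariz $S$-semialgebra (with respect to $A$). In particular, if $S$ is nilpotent-free and each minimal prime ideal of $S$ is subtractive, then $S[[X]]$, with the amount function sending $f$ to the ideal $A_f$ generated by all coefficients of $f$, is an Armendariz $S$-semialgebra.
   Context: A semiring is a set $S$ with operations $+,\cdot$ such that $(S,+,0)$ and $(S,\cdot,1)$ are commutative monoids with $1\neq 0$, multiplication distributes over addition, and $s\cdot 0=0$ for all $s$. An ideal of $S$ is a nonempty subset closed under addition and under multiplication by elements of $S$; $\mathrm{Id}(S)$ is the set of ideals. $IJ$ is the ideal of finite sums of products $xy$, $x\in I$, $y\in J$. A proper ideal $\mathfrak p$ is prime if $ab\in\mathfrak p$ implies $a\in\mathfrak p$ or $b\in\mathfrak p$. An ideal $I$ is subtractive if $a+b\in I$ and $a\in I$ imply $b\in I$. $\mathrm{Nil}(S)$ is the set of nilpotent elements of $S$. $S$ is nilpotent-free if $s^2=0$ implies $s=0$ for all $s\in S$. An $S$-semialgebra is a semiring $B$ together with a semiring morphism $\gamma: S\to B$ (preserving $+,\cdot,0,1$); write $sf=\gamma(s)f$. An amount function is a function $A: B\to \mathrm{Id}(S)$, $f\mapsto A_f$, such that for all $s\in S$, $f,g\in B$: (1) $A_0=(0)$ and $A_1=S$; (2) $A_f=(0)$ implies $f=0$; (3) $A_{sf}=sA_f$; (4) $A_{fg}\subseteq A_fA_g$. With respect to an amount function $A$, $B$ is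 a GGP (Gilmer–Grams–Parker) $S$-semialgebra if $fg=0$ implies $A_fA_g\subseteq\mathrm{Nil}(S)$ for all $f,g\in B$; $B$ is an Armendariz $S$-semialgebra if $fg=0$ implies $A_fA_g=(0)$ for all $f,g\in B$. *)

theory Defs
  imports "HOL-Computational_Algebra.Formal_Power_Series"
begin

text \<open>
  Semirings are types of class \<open>comm_semiring_1\<close>: both operations are commutative,
  \<open>0\<close> is absorbing and \<open>0 \<noteq> 1\<close>.
\<close>

definition semiring_ideal :: "'s::comm_semiring_1 set \<Rightarrow> bool" where
  "semiring_ideal I \<longleftrightarrow>
     I \<noteq> {} \<and> (\<forall>a\<in>I. \<forall>b\<in>I. a + b \<in> I) \<and> (\<forall>s. \<forall>a\<in>I. s * a \<in> I)"

definition ideal_generated :: "'s::comm_semiring_1 set \<Rightarrow> 's set" where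
  "ideal_generated X = \<Inter>{I. semiring_ideal I \<and> X \<subseteq> I}"

definition ideal_prod :: "'s::comm_semiring_1 set \<Rightarrow> 's set \<Rightarrow> 's set" where
  "ideal_prod I J = {\<Sum>k<n. x k * y k | (n::nat) x y. \<forall>k<n. x k \<in> I \<and> y k \<in> J}"

definition semiring_prime_ideal :: "'s::comm_semiring_1 set \<Rightarrow> bool" where
  "semiring_prime_ideal P \<longleftrightarrow>
     semiring_ideal P \<and> P \<noteq> UNIV \<and> (\<forall>a b. a * b \<in> P \<longrightarrow> a \<in> P \<or> b \<in> P)"

definition minimal_prime_ideal :: "'s::comm_semiring_1 set \<Rightarrow> bool" where
  "minimal_prime_ideal P \<longleftrightarrow>
     semiring_prime_ideal P \<and> (\<forall>Q. semiring_prime_ideal Q \<and> Q \<subseteq> P \<longrightarrow> Q = P)"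

definition subtractive_ideal :: "'s::comm_semiring_1 set \<Rightarrow> bool" where
  "subtractive_ideal I \<longleftrightarrow>
     semiring_ideal I \<and> (\<forall>a b. a + b \<in> I \<and> a \<in> I \<longrightarrow> b \<in> I)"

definition nilpotents :: "'s::comm_semiring_1 set" where
  "nilpotents = {s. \<exists>n>0. s ^ n = 0}"

definition nilpotent_free :: "'s::comm_semiring_1 itself \<Rightarrow> bool" where
  "nilpotent_free _ \<longleftrightarrow> (\<forall>s::'s. s\<^sup>2 = 0 \<longrightarrow> s = 0)"

text \<open>An \<open>S\<close>-semialgebra is given by its structure morphism \<open>\<gamma>\<close>.\<close>

definition semialgebra :: "('s::comm_semiring_1 \<Rightarrow> 'b::comm_semiring_1) \<Rightarrow> bool" where
  "semialgebra \<gamma> \<longleftrightarrow>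
     \<gamma> 0 = 0 \<and> \<gamma> 1 = 1 \<and> (\<forall>s t. \<gamma> (s + t) = \<gamma> s + \<gamma> t) \<and> (\<forall>s t. \<gamma> (s * t) = \<gamma> s * \<gamma> t)"

definition amount_function ::
    "('s::comm_semiring_1 \<Rightarrow> 'b::comm_semiring_1) \<Rightarrow> ('b \<Rightarrow> 's set) \<Rightarrow> bool" where
  "amount_function \<gamma> A \<longleftrightarrow>
     (\<forall>f. semiring_ideal (A f)) \<and>
     A 0 = {0} \<and> A 1 = UNIV \<and>
     (\<forall>f. A f = {0} \<longrightarrow> f = 0) \<and>
     (\<forall>s f. A (\<gamma> s * f) = (\<lambda>a. s * a) ` A f) \<and>
     (\<forall>f g. A (f * g) \<subseteq> ideal_prod (A f) (A g))"

definition GGP_semialgebra ::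
    "('s::comm_semiring_1 \<Rightarrow> 'b::comm_semiring_1) \<Rightarrow> ('b \<Rightarrow> 's set) \<Rightarrow> bool" where
  "GGP_semialgebra \<gamma> A \<longleftrightarrow>
     semialgebra \<gamma> \<and> amount_function \<gamma> A \<and>
     (\<forall>f g. f * g = 0 \<longrightarrow> ideal_prod (A f) (A g) \<subseteq> nilpotents)"

definition Armendariz_semialgebra ::
    "('s::comm_semiring_1 \<Rightarrow> 'b::comm_semiring_1) \<Rightarrow> ('b \<Rightarrow> 's set) \<Rightarrow> bool" where
  "Armendariz_semialgebra \<gamma> A \<longleftrightarrow>
     semialgebra \<gamma> \<and> amount_function \<gamma> A \<and>
     (\<forall>f g. f * g = 0 \<longrightarrow> ideal_prod (A f) (A g) = {0})"

definition fps_content :: "'s::comm_semiring_1 fps \<Rightarrow> 's set" where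
  "fps_content f = ideal_generated (range (fps_nth f))"

end

theory Submission
  imports Defs
begin

text \<open>
  In a nilpotent-free semiring the only nilpotent is \<open>0\<close>, so the first claim is immediate.
  For power series let \<open>f g = 0\<close>. If \<open>P\<close> is a subtractive prime and \<open>i\<close>, \<open>j\<close> are the least
  indices with \<open>f\<^sub>i \<notin> P\<close> and \<open>g\<^sub>j \<notin> P\<close>, then every other summand of the coefficient of
  \<open>X\<^bsup>i+j\<^esup>\<close> lies in \<open>P\<close>, hence so does \<open>f\<^sub>i g\<^sub>j\<close>, a contradiction. Thus every \<open>f\<^sub>i g\<^sub>j\<close> lies in all
  minimal primes. These are the complements of the maximal multiplicative sets avoiding \<open>0\<close>, and
  by Zorn's lemma every non-nilpotent element lies in such a set; so \<open>f\<^sub>i g\<^sub>j = 0\<close>.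
\<close>

section \<open>Ideals\<close>

lemma semiring_idealI:
  assumes "0 \<in> I" "\<And>a b. a \<in> I \<Longrightarrow> b \<in> I \<Longrightarrow> a + b \<in> I" "\<And>s a. a \<in> I \<Longrightarrow> s * a \<in> I"
  shows "semiring_ideal I"
  using assms unfolding semiring_ideal_def by blast

lemma semiring_ideal_add: "semiring_ideal I \<Longrightarrow> a \<in> I \<Longrightarrow> b \<in> I \<Longrightarrow> a + b \<in> I"
  by (simp add: semiring_ideal_def)

lemma semiring_ideal_mult: "semiring_ideal I \<Longrightarrow> a \<in> I \<Longrightarrow> s * a \<in> I"
  by (simp add: semiring_ideal_def)

lemma semiring_ideal_zero:
  assumes "semiring_ideal I"
  shows "0 \<in> I"
proof -
  obtain a where "a \<in> I" using assms by (auto simp: semiring_ideal_def)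
  then show ?thesis using semiring_ideal_mult[OF assms, of a 0] by simp
qed

lemma semiring_ideal_sum:
  assumes "semiring_ideal I" and "\<And>k. k \<in> K \<Longrightarrow> h k \<in> I"
  shows "sum h K \<in> I"
  using assms(2)
proof (induction K rule: infinite_finite_induct)
  case (insert k K)
  then show ?case by (simp add: semiring_ideal_add assms(1))
qed (use semiring_ideal_zero[OF assms(1)] in auto)

lemma semiring_ideal_ideal_generated: "semiring_ideal (ideal_generated X)"
  by (rule semiring_idealI)
    (auto simp: ideal_generated_def
      intro: semiring_ideal_zero semiring_ideal_add semiring_ideal_mult)

lemma ideal_generated_superset: "X \<subseteq> ideal_generated X"
  by (auto simp: ideal_generated_def)

lemma ideal_generated_least:
  assumes "semiring_ideal I" and "X \<subseteq> I"
  shows "ideal_generated X \<subseteq> I"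
  using assms by (auto simp: ideal_generated_def)

text \<open>The set is the colon ideal \<open>(I : s)\<close>. It lets an inclusion of the form
  \<open>s * a \<in> I\<close> be checked on generators \<open>a\<close> only.\<close>

lemma semiring_ideal_mult_vimage:
  assumes "semiring_ideal I"
  shows "semiring_ideal {a. s * a \<in> I}"
proof (rule semiring_idealI)
  fix t a assume "a \<in> {a. s * a \<in> I}"
  then show "t * a \<in> {a. s * a \<in> I}"
    using semiring_ideal_mult[OF assms, of "s * a" t] by (simp add: mult.left_commute)
qed (simp_all add: semiring_ideal_zero semiring_ideal_add assms distrib_left)

lemma semiring_ideal_mult_image:
  assumes "semiring_ideal I"
  shows "semiring_ideal ((\<lambda>a. s * a) ` I)"
proof (rule semiring_idealI)
  show "0 \<in> (\<lambda>a. s * a) ` I"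
    using semiring_ideal_zero[OF assms] by (intro image_eqI[of _ _ 0]) auto
next
  fix x y assume "x \<in> (\<lambda>a. s * a) ` I" "y \<in> (\<lambda>a. s * a) ` I"
  then obtain a b where "x = s * a" "y = s * b" "a \<in> I" "b \<in> I" by blast
  then show "x + y \<in> (\<lambda>a. s * a) ` I"
    by (intro image_eqI[of _ _ "a + b"]) (simp_all add: distrib_left semiring_ideal_add assms)
next
  fix t x assume "x \<in> (\<lambda>a. s * a) ` I"
  then obtain a where "x = s * a" "a \<in> I" by blast
  then show "t * x \<in> (\<lambda>a. s * a) ` I"
    by (intro image_eqI[of _ _ "t * a"])
      (simp_all add: mult.left_commute semiring_ideal_mult assms)
qed

lemma ideal_generated_mult_image:
  "ideal_generated ((\<lambda>a. s * a) ` X) = (\<lambda>a. s * a) ` ideal_generated X"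
proof
  show "ideal_generated ((\<lambda>a. s * a) ` X) \<subseteq> (\<lambda>a. s * a) ` ideal_generated X"
    by (intro ideal_generated_least semiring_ideal_mult_image semiring_ideal_ideal_generated
        image_mono ideal_generated_superset)
  have "ideal_generated X \<subseteq> {a. s * a \<in> ideal_generated ((\<lambda>a. s * a) ` X)}"
    using ideal_generated_superset[of "(\<lambda>a. s * a) ` X"]
    by (intro ideal_generated_least semiring_ideal_mult_vimage semiring_ideal_ideal_generated) auto
  then show "(\<lambda>a. s * a) ` ideal_generated X \<subseteq> ideal_generated ((\<lambda>a. s * a) ` X)"
    by auto
qed

lemma semiring_ideal_annihilator: "semiring_ideal {a. \<forall>y\<in>Y. a * y = 0}"
  by (rule semiring_idealI) (simp_all add: distrib_right mult.assoc)

section \<open>Products of ideals\<close>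

lemma zero_in_ideal_prod: "0 \<in> ideal_prod I J"
  unfolding ideal_prod_def by (auto intro!: exI[of _ "0::nat"])

lemma ideal_prod_add_mult:
  assumes "p \<in> ideal_prod I J" "a \<in> I" "b \<in> J"
  shows "p + a * b \<in> ideal_prod I J"
proof -
  obtain n :: nat and x y where p: "p = (\<Sum>k<n. x k * y k)" "\<forall>k<n. x k \<in> I \<and> y k \<in> J"
    using assms(1) by (auto simp: ideal_prod_def)
  have "p + a * b = (\<Sum>k<Suc n. (x(n := a)) k * (y(n := b)) k)"
    by (simp add: p(1))
  moreover have "\<forall>k<Suc n. (x(n := a)) k \<in> I \<and> (y(n := b)) k \<in> J"
    using assms p(2) by (auto simp: less_Suc_eq)
  ultimately show ?thesis unfolding ideal_prod_def by blast
qed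

text \<open>Appending the summands one at a time avoids concatenating two indexed families when sums
  of products are added.\<close>

lemma ideal_prod_add_sum:
  assumes "p \<in> ideal_prod I J" and "\<And>k. k < n \<Longrightarrow> x k \<in> I \<and> y k \<in> J"
  shows "p + (\<Sum>k<(n::nat). x k * y k) \<in> ideal_prod I J"
  using assms(2)
proof (induction n)
  case (Suc n)
  then have "(p + (\<Sum>k<n. x k * y k)) + x n * y n \<in> ideal_prod I J"
    by (intro ideal_prod_add_mult) auto
  then show ?case by (simp add: add.assoc)
qed (simp add: assms(1))

lemma semiring_ideal_ideal_prod:
  assumes "semiring_ideal I"
  shows "semiring_ideal (ideal_prod I J)"
proof (rule semiring_idealI)
  show "0 \<in> ideal_prod I J" by (rule zero_in_ideal_prod)
next
  fix p q assume p: "p \<in> ideal_prod I J" and "q \<in> ideal_prod I J"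
  then obtain n :: nat and x y where q: "q = (\<Sum>k<n. x k * y k)" "\<forall>k<n. x k \<in> I \<and> y k \<in> J"
    by (auto simp: ideal_prod_def)
  show "p + q \<in> ideal_prod I J"
    unfolding q(1) using q(2) by (intro ideal_prod_add_sum[OF p]) blast
next
  fix s p assume "p \<in> ideal_prod I J"
  then obtain n :: nat and x y where p: "p = (\<Sum>k<n. x k * y k)" "\<forall>k<n. x k \<in> I \<and> y k \<in> J"
    by (auto simp: ideal_prod_def)
  have "s * p = (\<Sum>k<n. (s * x k) * y k)"
    by (simp add: p(1) sum_distrib_left mult.assoc)
  moreover have "\<forall>k<n. s * x k \<in> I \<and> y k \<in> J"
    using p(2) by (simp add: semiring_ideal_mult assms)
  ultimately show "s * p \<in> ideal_prod I J"
    using ideal_prod_add_sum[OF zero_in_ideal_prod, of n "\<lambda>k. s * x k" I y J] by simp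
qed

lemma mult_in_ideal_prod:
  assumes "a \<in> I" "b \<in> J"
  shows "a * b \<in> ideal_prod I J"
  using ideal_prod_add_mult[OF zero_in_ideal_prod assms] by simp

lemma ideal_prod_eq_zeroI:
  assumes "\<And>a b. a \<in> I \<Longrightarrow> b \<in> J \<Longrightarrow> a * b = 0"
  shows "ideal_prod I J = {0}"
proof
  show "ideal_prod I J \<subseteq> {0}"
    using assms by (auto simp: ideal_prod_def intro!: sum.neutral)
qed (simp add: zero_in_ideal_prod)

section \<open>Nilpotent elements\<close>

lemma nilpotent_free_power_eq_zero:
  fixes s :: "'s::comm_semiring_1"
  assumes nf: "nilpotent_free TYPE('s)" and "s ^ n = 0"
  shows "s = 0"
proof -
  \<comment> \<open>Nilpotent-freeness speaks of squares only, so exponents that are powers of two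
    are halved repeatedly. Since \<open>n \<le> 2 ^ n\<close>, an arbitrary exponent
    \<open>n\<close> can be raised to \<open>2 ^ n\<close> first.\<close>
  have sq: "t = 0" if "t ^ (2 ^ k) = 0" for t :: 's and k :: nat
    using that
  proof (induction k arbitrary: t)
    case (Suc k)
    then have "(t\<^sup>2) ^ (2 ^ k) = 0" by (simp add: power_mult)
    then have "t\<^sup>2 = 0" by (rule Suc.IH)
    then show ?case using nf by (simp add: nilpotent_free_def)
  qed simp
  have "s ^ (2 ^ n) = s ^ n * s ^ (2 ^ n - n)"
    by (simp flip: power_add)
  then show ?thesis using sq[of s n] assms(2) by simp
qed

section \<open>Minimal primes avoid non-nilpotent elements\<close>

definition zero_free_mult_set :: "'s::comm_semiring_1 set \<Rightarrow> bool" where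
  "zero_free_mult_set M \<longleftrightarrow> 1 \<in> M \<and> 0 \<notin> M \<and> (\<forall>x\<in>M. \<forall>y\<in>M. x * y \<in> M)"

text \<open>Zorn's lemma applies because the powers of \<open>a\<close> form one such set and unions
  of nonempty chains stay in the family.\<close>

lemma exists_maximal_zero_free_mult_set:
  fixes a :: "'s::comm_semiring_1"
  assumes "\<And>n. a ^ n \<noteq> 0"
  obtains M where "zero_free_mult_set M" "a \<in> M"
    "\<And>N. zero_free_mult_set N \<Longrightarrow> M \<subseteq> N \<Longrightarrow> N = M"
proof -
  let ?F = "{M. zero_free_mult_set M \<and> a \<in> M}"
  have "range (\<lambda>n. a ^ n) \<in> ?F"
    using assms rangeI[of "\<lambda>n. a ^ n" 0] rangeI[of "\<lambda>n. a ^ n" 1]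
    by (auto simp: zero_free_mult_set_def simp flip: power_add)
  then have "?F \<noteq> {}" by blast
  moreover have "\<Union>C \<in> ?F" if "C \<noteq> {}" "subset.chain ?F C" for C
  proof -
    \<comment> \<open>Both factors lie in the larger of the two chain members, which is closed under
      products.\<close>
    have "x * y \<in> \<Union>C" if xy: "x \<in> M" "M \<in> C" "y \<in> N" "N \<in> C" for x y M N
    proof -
      have "M \<subseteq> N \<or> N \<subseteq> M" "zero_free_mult_set M" "zero_free_mult_set N"
        using \<open>subset.chain ?F C\<close> xy by (auto simp: subset_chain_def)
      then show ?thesis using xy unfolding zero_free_mult_set_def by blast
    qed
    then have "\<forall>x\<in>\<Union>C. \<forall>y\<in>\<Union>C. x * y \<in> \<Union>C" by blast
    moreover have "1 \<in> M \<and> 0 \<notin> M \<and> a \<in> M" if "M \<in> C" for M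
      using \<open>subset.chain ?F C\<close> that by (auto simp: subset_chain_def zero_free_mult_set_def)
    ultimately show ?thesis
      using \<open>C \<noteq> {}\<close> unfolding zero_free_mult_set_def by blast
  qed
  ultimately obtain M where "M \<in> ?F" "\<forall>N\<in>?F. M \<subseteq> N \<longrightarrow> N = M"
    using subset_Zorn_nonempty[of ?F] by blast
  then show thesis using that by blast
qed

text \<open>By maximality, adjoining an outside element \<open>x\<close> to \<open>M\<close> must
  produce \<open>0\<close>. This turns membership in the complement into an equation that can be
  computed with.\<close>

lemma maximal_zero_free_mult_set_notin_iff:
  assumes M: "zero_free_mult_set M"
    and max: "\<And>N. zero_free_mult_set N \<Longrightarrow> M \<subseteq> N \<Longrightarrow> N = M"
  shows "x \<notin> M \<longleftrightarrow> (\<exists>m\<in>M. \<exists>n. m * x ^ n = 0)"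
proof
  assume "x \<notin> M"
  show "\<exists>m\<in>M. \<exists>n. m * x ^ n = 0"
  proof (rule ccontr)
    assume nz: "\<not> ?thesis"
    \<comment> \<open>The multiplicative set generated by \<open>M\<close> and \<open>x\<close>:
      exponent 0 recovers \<open>M\<close>, and \<open>m = 1\<close> with exponent 1 gives
      \<open>x\<close>.\<close>
    define N where "N = {m * x ^ n | m n. m \<in> M}"
    have "u * v \<in> N" if "u \<in> N" "v \<in> N" for u v
    proof -
      obtain m n m' n' where uv: "u = m * x ^ n" "v = m' * x ^ n'" "m \<in> M" "m' \<in> M"
        using \<open>u \<in> N\<close> \<open>v \<in> N\<close> by (auto simp: N_def)
      have "u * v = (m * m') * x ^ (n + n')"
        by (simp add: uv power_add ac_simps)
      moreover have "m * m' \<in> M" using uv M by (simp add: zero_free_mult_set_def)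
      ultimately show ?thesis by (auto simp: N_def)
    qed
    moreover have "M \<subseteq> N" unfolding N_def by (force intro: exI[of _ "0::nat"])
    moreover have "0 \<notin> N" using nz unfolding N_def by fastforce
    ultimately have "zero_free_mult_set N"
      using M unfolding zero_free_mult_set_def by blast
    then have "N = M" using max \<open>M \<subseteq> N\<close> by blast
    moreover have "1 * x ^ 1 \<in> N" using M unfolding N_def zero_free_mult_set_def by blast
    ultimately show False using \<open>x \<notin> M\<close> by simp
  qed
next
  assume "\<exists>m\<in>M. \<exists>n. m * x ^ n = 0"
  then obtain m n where mn: "m \<in> M" "m * x ^ n = 0" by blast
  show "x \<notin> M"
  proof
    assume "x \<in> M"
    then have "x ^ n \<in> M"
      using M by (induction n) (auto simp: zero_free_mult_set_def)
    then show False using mn M by (metis zero_free_mult_set_def)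
  qed
qed

text \<open>The annihilation criterion \<open>notin\<close> makes the complement an ideal, and
  closure of \<open>M\<close> under products makes it prime. A prime inside it has a complement
  containing \<open>M\<close>, so maximality of \<open>M\<close> yields minimality.\<close>

lemma minimal_prime_ideal_compl:
  assumes M: "zero_free_mult_set M"
    and max: "\<And>N. zero_free_mult_set N \<Longrightarrow> M \<subseteq> N \<Longrightarrow> N = M"
  shows "minimal_prime_ideal (- M)"
proof -
  have notin: "x \<notin> M \<longleftrightarrow> (\<exists>m\<in>M. \<exists>n. m * x ^ n = 0)" for x
    using max by (intro maximal_zero_free_mult_set_notin_iff[OF M]) blast
  have add: "x + y \<in> - M" if xy: "x \<in> - M" "y \<in> - M" for x y
  proof -
    obtain m n m' n' where *: "m \<in> M" "m * x ^ n = 0" "m' \<in> M" "m' * y ^ n' = 0"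
      using xy notin[of x] notin[of y] by blast
    \<comment> \<open>In each binomial term either \<open>x\<close> has exponent at least
      \<open>n\<close>, so \<open>m\<close> kills the term, or \<open>y\<close> has exponent at
      least \<open>n'\<close>, so \<open>m'\<close> does.\<close>
    have "m * m' * (of_nat (n + n' choose k) * x ^ k * y ^ (n + n' - k)) = 0" for k
    proof (cases "n \<le> k")
      case True
      then have "x ^ k = x ^ n * x ^ (k - n)" by (simp flip: power_add)
      then have "m * m' * (of_nat (n + n' choose k) * x ^ k * y ^ (n + n' - k))
          = (m * x ^ n) * (m' * of_nat (n + n' choose k) * x ^ (k - n) * y ^ (n + n' - k))"
        by (simp only: ac_simps)
      then show ?thesis by (simp add: *)
    next
      case False
      then have "y ^ (n + n' - k) = y ^ n' * y ^ (n - k)"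
        by (simp add: add.commute flip: power_add)
      then have "m * m' * (of_nat (n + n' choose k) * x ^ k * y ^ (n + n' - k))
          = (m' * y ^ n') * (m * of_nat (n + n' choose k) * x ^ k * y ^ (n - k))"
        by (simp only: ac_simps)
      then show ?thesis by (simp add: *)
    qed
    then have "m * m' * (x + y) ^ (n + n') = 0"
      by (simp add: binomial_ring sum_distrib_left)
    moreover have "m * m' \<in> M" using * M by (simp add: zero_free_mult_set_def)
    ultimately show ?thesis using notin[of "x + y"] by blast
  qed
  have mult: "s * x \<in> - M" if x: "x \<in> - M" for s x
  proof -
    obtain m n where *: "m \<in> M" "m * x ^ n = 0" using x notin[of x] by blast
    have "m * (s * x) ^ n = (m * x ^ n) * s ^ n"
      by (simp add: power_mult_distrib ac_simps)
    then show ?thesis using * notin[of "s * x"] by auto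
  qed
  have "semiring_ideal (- M)"
    using M by (intro semiring_idealI add mult) (simp_all add: zero_free_mult_set_def)
  then have "semiring_prime_ideal (- M)"
    using M unfolding semiring_prime_ideal_def zero_free_mult_set_def by blast
  moreover have "Q = - M" if Q: "semiring_prime_ideal Q" "Q \<subseteq> - M" for Q
  proof -
    have id: "semiring_ideal Q" using Q by (simp add: semiring_prime_ideal_def)
    have "1 \<notin> Q"
      using Q(1) semiring_ideal_mult[OF id, of 1] by (auto simp: semiring_prime_ideal_def)
    then have "zero_free_mult_set (- Q)"
      using Q semiring_ideal_zero[OF id]
      by (auto simp: zero_free_mult_set_def semiring_prime_ideal_def)
    then show ?thesis using max[of "- Q"] Q by blast
  qed
  ultimately show ?thesis by (simp add: minimal_prime_ideal_def)
qed

lemma exists_minimal_prime_ideal_avoiding: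
  fixes a :: "'s::comm_semiring_1"
  assumes "\<And>n. a ^ n \<noteq> 0"
  obtains P where "minimal_prime_ideal P" "a \<notin> P"
proof -
  obtain M where M: "zero_free_mult_set M" "a \<in> M"
    and max: "\<And>N. zero_free_mult_set N \<Longrightarrow> M \<subseteq> N \<Longrightarrow> N = M"
    using exists_maximal_zero_free_mult_set[OF assms] by blast
  have "minimal_prime_ideal (- M)"
    using max by (intro minimal_prime_ideal_compl[OF M(1)]) blast
  then show thesis using M(2) by (intro that) auto
qed

section \<open>The content of a power series\<close>

lemma semialgebra_fps_const: "semialgebra (fps_const :: 's::comm_semiring_1 \<Rightarrow> 's fps)"
  by (simp add: semialgebra_def)

lemma fps_nth_in_fps_content: "fps_nth f n \<in> fps_content f"
  unfolding fps_content_def by (rule subsetD[OF ideal_generated_superset rangeI])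

lemma semiring_ideal_fps_content: "semiring_ideal (fps_content f)"
  by (simp add: fps_content_def semiring_ideal_ideal_generated)

lemma fps_content_0: "fps_content 0 = {0}"
proof
  show "fps_content 0 \<subseteq> {0}"
    unfolding fps_content_def by (rule ideal_generated_least) (auto simp: semiring_ideal_def)
qed (simp add: semiring_ideal_zero semiring_ideal_fps_content)

lemma fps_content_1: "fps_content 1 = UNIV"
proof -
  \<comment> \<open>The constant coefficient of the series \<open>1\<close> is the unit of the
    semiring.\<close>
  have "s * 1 \<in> fps_content 1" for s :: 'a
    using fps_nth_in_fps_content[of "1 :: 'a fps" 0]
    by (intro semiring_ideal_mult semiring_ideal_fps_content) simp
  then show ?thesis by auto
qed

lemma fps_content_const_mult:
  "fps_content (fps_const s * f) = (\<lambda>a. s * a) ` fps_content f"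
proof -
  have "range (fps_nth (fps_const s * f)) = (\<lambda>a. s * a) ` range (fps_nth f)"
    by (auto simp: image_image)
  then show ?thesis by (simp add: fps_content_def ideal_generated_mult_image)
qed

lemma fps_content_mult_subset:
  "fps_content (f * g) \<subseteq> ideal_prod (fps_content f) (fps_content g)"
  unfolding fps_content_def[of "f * g"]
proof (rule ideal_generated_least)
  show id: "semiring_ideal (ideal_prod (fps_content f) (fps_content g))"
    by (intro semiring_ideal_ideal_prod semiring_ideal_fps_content)
  show "range (fps_nth (f * g)) \<subseteq> ideal_prod (fps_content f) (fps_content g)"
    by (auto simp: fps_mult_nth
        intro!: semiring_ideal_sum[OF id] mult_in_ideal_prod fps_nth_in_fps_content)
qed

lemma amount_function_fps_content:
  "amount_function (fps_const :: 's::comm_semiring_1 \<Rightarrow> 's fps) fps_content"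
  unfolding amount_function_def
proof (intro conjI allI impI)
  fix f :: "'s fps" assume "fps_content f = {0}"
  then have "fps_nth f n = 0" for n using fps_nth_in_fps_content[of f n] by simp
  then show "f = 0" by (simp add: fps_eq_iff)
qed (simp_all add: semiring_ideal_fps_content fps_content_0 fps_content_1
      fps_content_const_mult fps_content_mult_subset)

section \<open>Zero products of power series\<close>

lemma fps_nth_mult_in_subtractive_prime:
  assumes prime: "semiring_prime_ideal P" and sub: "subtractive_ideal P" and "f * g = 0"
  shows "fps_nth f i * fps_nth g j \<in> P"
proof (rule ccontr)
  have id: "semiring_ideal P" using prime by (simp add: semiring_prime_ideal_def)
  have multl: "x * y \<in> P" if "x \<in> P" for x y
    using semiring_ideal_mult[OF id that, of y] by (simp add: mult.commute)
  have multr: "x * y \<in> P" if "y \<in> P" for x y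
    by (rule semiring_ideal_mult[OF id that])
  assume "fps_nth f i * fps_nth g j \<notin> P"
  then have "fps_nth f i \<notin> P" "fps_nth g j \<notin> P" using multl multr by blast+
  moreover have "\<exists>i'. fps_nth h i' \<notin> P \<and> (\<forall>k<i'. fps_nth h k \<in> P)"
    if "fps_nth h i \<notin> P" for h i
    using that exists_least_iff[of "\<lambda>k. fps_nth h k \<notin> P"] by blast
  ultimately obtain i' j' where i': "fps_nth f i' \<notin> P" "\<And>k. k < i' \<Longrightarrow> fps_nth f k \<in> P"
    and j': "fps_nth g j' \<notin> P" "\<And>k. k < j' \<Longrightarrow> fps_nth g k \<in> P"
    by blast
  let ?h = "\<lambda>k. fps_nth f k * fps_nth g (i' + j' - k)"
  have rest: "sum ?h ({0..i' + j'} - {i'}) \<in> P"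
  proof (rule semiring_ideal_sum[OF id])
    fix k assume "k \<in> {0..i' + j'} - {i'}"
    \<comment> \<open>An index \<open>k\<close> other than \<open>i'\<close> is either below
      \<open>i'\<close> or so large that the complementary index falls below
      \<open>j'\<close>.\<close>
    then have "k < i' \<or> i' + j' - k < j'" by auto
    then show "?h k \<in> P" using i'(2) j'(2) multl multr by blast
  qed
  have "sum ?h {0..i' + j'} = 0"
    using \<open>f * g = 0\<close> by (metis fps_mult_nth fps_zero_nth)
  then have "sum ?h ({0..i' + j'} - {i'}) + ?h i' = 0"
    by (subst (asm) sum.remove[of _ i']) (auto simp: add.commute)
  \<comment> \<open>The remaining summands and the total \<open>0\<close> both lie in
    \<open>P\<close>; subtractivity replaces the missing additive inverses.\<close>
  then have "?h i' \<in> P"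
    using sub rest semiring_ideal_zero[OF id] unfolding subtractive_ideal_def by metis
  then show False
    using prime i'(1) j'(1) unfolding semiring_prime_ideal_def by auto
qed

lemma fps_content_prod_eq_zero:
  fixes f g :: "'s::comm_semiring_1 fps"
  assumes nf: "nilpotent_free TYPE('s)"
    and sub: "\<And>P :: 's set. minimal_prime_ideal P \<Longrightarrow> subtractive_ideal P"
    and "f * g = 0"
  shows "ideal_prod (fps_content f) (fps_content g) = {0}"
proof -
  have coeff: "fps_nth f i * fps_nth g j = 0" for i j
  proof (rule ccontr)
    assume "fps_nth f i * fps_nth g j \<noteq> 0"
    then have "(fps_nth f i * fps_nth g j) ^ n \<noteq> 0" for n
      using nilpotent_free_power_eq_zero[OF nf] by blast
    then obtain P where "minimal_prime_ideal P" "fps_nth f i * fps_nth g j \<notin> P"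
      using exists_minimal_prime_ideal_avoiding by blast
    then show False
      using fps_nth_mult_in_subtractive_prime[OF _ sub \<open>f * g = 0\<close>]
      by (auto simp: minimal_prime_ideal_def)
  qed
  \<comment> \<open>Annihilators are ideals, so the vanishing of coefficient products extends from
    generators to contents one factor at a time: first \<open>f\<close>, then
    \<open>g\<close>.\<close>
  have f: "fps_content f \<subseteq> {a. \<forall>y\<in>range (fps_nth g). a * y = 0}"
    unfolding fps_content_def
    by (rule ideal_generated_least[OF semiring_ideal_annihilator]) (auto simp: coeff)
  have "fps_content g \<subseteq> {b. \<forall>y\<in>fps_content f. b * y = 0}"
    unfolding fps_content_def[of g]
    by (rule ideal_generated_least[OF semiring_ideal_annihilator])
      (use f in \<open>auto simp: mult.commute\<close>)
  then show ?thesis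
    by (intro ideal_prod_eq_zeroI) (subst mult.commute, blast)
qed

theorem corollary4p5:
  assumes "nilpotent_free TYPE('s::comm_semiring_1)"
  shows "(\<forall>(\<gamma> :: 's \<Rightarrow> 'b::comm_semiring_1) A.
            GGP_semialgebra \<gamma> A \<longrightarrow> Armendariz_semialgebra \<gamma> A) \<and>
         ((\<forall>P :: 's set. minimal_prime_ideal P \<longrightarrow> subtractive_ideal P) \<longrightarrow>
            Armendariz_semialgebra (fps_const :: 's \<Rightarrow> 's fps) fps_content)"
proof (intro conjI allI impI)
  fix \<gamma> :: "'s \<Rightarrow> 'b" and A
  assume "GGP_semialgebra \<gamma> A"
  moreover have "(nilpotents :: 's set) \<subseteq> {0}"
    using nilpotent_free_power_eq_zero[OF assms] by (auto simp: nilpotents_def)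
  ultimately show "Armendariz_semialgebra \<gamma> A"
    using zero_in_ideal_prod unfolding GGP_semialgebra_def Armendariz_semialgebra_def by blast
next
  assume "\<forall>P :: 's set. minimal_prime_ideal P \<longrightarrow> subtractive_ideal P"
  then show "Armendariz_semialgebra (fps_const :: 's \<Rightarrow> 's fps) fps_content"
    by (simp add: Armendariz_semialgebra_def semialgebra_fps_const amount_function_fps_content
        fps_content_prod_eq_zero[OF assms])
qed

end
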